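(* Let $\beta>0$, $0<c<1$ and $n,m\in\mathbb{N}$. Then for all $x$, $$M_{m+n}(x;\beta,c)=\sum_{k=0}^{\min(n,m)}\frac{(-n)_k(-m)_k(\beta+x)_k}{k!\,(\beta)_k(\beta+n)_k}\left(\frac{c-1}{c}\right)^kM_{n-k}(x;\beta+k,c)\,M_{m-k}(x-n;\beta+n+k,c).$$
   Context: $\mathbb N=\{0,1,2,\dots\}$, $(y)_k=y(y+1)\cdots(y+k-1)$. The Meixner polynomials are $$M_n(x;\beta,c)=\sum_{j=0}^n\frac{(-n)_j(-x)_j}{(\beta)_j\,j!}\left(\frac{c-1}{c}\right)^j,$$ polynomials of degree $n$ in $x$. *)

theory Defs
  imports Complex_Main
begin

definition meixner :: "nat \<Rightarrow> 'a::field_char_0 \<Rightarrow> 'a \<Rightarrow> 'a \<Rightarrow> 'a" where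
  "meixner n x \<beta> c =
     (\<Sum>j=0..n. pochhammer (- of_nat n) j * pochhammer (- x) j / (pochhammer \<beta> j * fact j)
                 * ((c - 1) / c) ^ j)"

end

theory Submission
  imports Defs
begin

text \<open>
  The identity is the Leibniz rule applied to a Rodrigues formula. With the negative binomial
  weight \<open>w\<^sub>\<beta> x = (\<beta>)\<^sub>x c\<^sup>x / x!\<close> and the backward difference \<open>\<nabla>\<close>,
  the Meixner polynomials satisfy \<open>w\<^sub>\<beta> M\<^sub>n(\<cdot>; \<beta>) = \<nabla>\<^sup>n w\<^bsub>\<beta>+n\<^esub>\<close>. Splitting \<open>\<nabla>\<^bsup>m+n\<^esup> = \<nabla>\<^sup>n \<nabla>\<^sup>m\<close>
  gives \<open>w\<^sub>\<beta> M\<^bsub>m+n\<^esub>(\<cdot>; \<beta>) = \<nabla>\<^sup>n (w\<^bsub>\<beta>+n\<^esub> M\<^sub>m(\<cdot>; \<beta> + n))\<close>, and the Leibniz rule expands the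
  right-hand side into products of \<open>\<nabla>\<^bsup>n-k\<^esup> w\<^bsub>\<beta>+n\<^esub> = w\<^bsub>\<beta>+k\<^esub> M\<^bsub>n-k\<^esub>(\<cdot>; \<beta> + k)\<close> with
  \<open>\<nabla>\<^sup>k M\<^sub>m(\<cdot>; \<beta> + n)\<close> at a point shifted by \<open>n - k\<close>. The latter is a multiple of
  \<open>M\<^bsub>m-k\<^esub>(x - n; \<beta> + n + k)\<close>, and \<open>w\<^bsub>\<beta>+k\<^esub> x / w\<^sub>\<beta> x = (\<beta> + x)\<^sub>k / (\<beta>)\<^sub>k\<close>.

  The weight only makes sense at natural arguments, so it is divided out: the operator
  \<open>f \<mapsto> \<nabla>(w\<^bsub>\<beta>+1\<^esub> f) / w\<^sub>\<beta>\<close> has coefficients that are polynomial in \<open>x\<close>, and with it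
  the argument works verbatim at every \<open>x\<close> in any field of characteristic 0. The
  Rodrigues formula becomes \<open>meixner_Suc_eq_raise\<close>, the Leibniz rule \<open>raise_iter_leibniz\<close>, and
  the differences of \<open>M\<^sub>m\<close> are computed in \<open>nabla_funpow_meixner\<close>.
\<close>

section \<open>Two contiguous relations\<close>

text \<open>
  Terms with \<open>j > n\<close> vanish, so polynomials of different degrees can be summed over a
  common range and compared coefficientwise.
\<close>
lemma meixner_extend:
  assumes "n \<le> N"
  shows "meixner n x b c =
    (\<Sum>j\<le>N. pochhammer (- of_nat n) j * pochhammer (- x) j / (pochhammer b j * fact j) * ((c - 1) / c) ^ j)"
  unfolding meixner_def atMost_atLeast0
  by (rule sum.mono_neutral_left) (use assms in \<open>auto simp: pochhammer_of_nat_eq_0_iff\<close>)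

lemma meixner_0 [simp]: "meixner 0 x b c = 1"
  by (simp add: meixner_def)

lemma pochhammer_neq_0:
  fixes b :: "'a::field_char_0"
  assumes "\<And>j. b + of_nat j \<noteq> 0"
  shows "pochhammer b k \<noteq> 0"
  using assms by (auto simp: pochhammer_prod)

definition nabla :: "('a \<Rightarrow> 'a) \<Rightarrow> 'a \<Rightarrow> 'a::field_char_0" where
  "nabla f x = f x - f (x - 1)"

text \<open>
  Termwise this is \<open>\<nabla> (-x)\<^sub>j = - j (1 - x)\<^bsub>j-1\<^esub>\<close>; the argument \<open>x - 1\<close> on the right
  comes from the rising factorial starting at \<open>1 - x\<close>.
\<close>
lemma nabla_meixner:
  fixes b :: "'a::field_char_0"
  assumes b: "\<And>j. b + of_nat j \<noteq> 0"
  shows "nabla (\<lambda>y. meixner n y b c) x =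
    of_nat n * ((c - 1) / c) / b * meixner (n - 1) (x - 1) (b + 1) c"
proof (cases n)
  case 0
  then show ?thesis by (simp add: nabla_def)
next
  case (Suc m)
  define z where "z = (c - 1) / c"
  have b0: "b \<noteq> 0" using b[of 0] by simp
  have b1: "pochhammer (b + 1) j \<noteq> 0" for j
    using pochhammer_neq_0[OF b, of "Suc j"] by (simp add: pochhammer_rec)
  have diff: "pochhammer (- x) (Suc j) - pochhammer (1 - x) (Suc j) = - of_nat (Suc j) * pochhammer (1 - x) j" for j
    using pochhammer_rec[of "- x" j] pochhammer_Suc[of "1 - x" j]
    by (simp add: algebra_simps)
  have "nabla (\<lambda>y. meixner n y b c) x =
     (\<Sum>j\<le>Suc m. pochhammer (- of_nat n) j / (pochhammer b j * fact j) * z ^ j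
        * (pochhammer (- x) j - pochhammer (1 - x) j))"
    unfolding nabla_def meixner_extend[of n "Suc m", OF eq_refl[OF Suc]] sum_subtractf[symmetric] z_def
    by (rule sum.cong[OF refl]) (simp add: right_diff_distrib diff_divide_distrib mult_ac)
  also have "\<dots> = (\<Sum>j\<le>m. pochhammer (- of_nat n) (Suc j) / (pochhammer b (Suc j) * fact (Suc j)) * z ^ Suc j
        * (- of_nat (Suc j) * pochhammer (1 - x) j))"
    by (subst sum.atMost_Suc_shift) (simp only: diff pochhammer_0 diff_self mult_zero_right add_0)
  also have "\<dots> = (\<Sum>j\<le>m. of_nat n * z / b * (pochhammer (- of_nat m) j * pochhammer (- (x - 1)) j
        / (pochhammer (b + 1) j * fact j) * z ^ j))"
  proof (rule sum.cong[OF refl])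
    fix j
    have "pochhammer (- of_nat n :: 'a) (Suc j) = - of_nat n * pochhammer (- of_nat m) j"
      by (simp add: pochhammer_rec Suc)
    moreover have "pochhammer b (Suc j) = b * pochhammer (b + 1) j"
      by (rule pochhammer_rec)
    moreover have "(of_nat (Suc j) :: 'a) \<noteq> 0" by (rule of_nat_neq_0)
    ultimately show "pochhammer (- of_nat n) (Suc j) / (pochhammer b (Suc j) * fact (Suc j)) * z ^ Suc j
        * (- of_nat (Suc j) * pochhammer (1 - x) j) = of_nat n * z / b * (pochhammer (- of_nat m) j * pochhammer (- (x - 1)) j
        / (pochhammer (b + 1) j * fact j) * z ^ j)"
      using b0 b1[of j] by (simp add: field_simps del: of_nat_Suc)
  qed
  also have "\<dots> = of_nat n * z / b * meixner m (x - 1) (b + 1) c"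
    by (simp add: meixner_extend[of m m] sum_distrib_left z_def)
  finally show ?thesis by (simp add: Suc z_def)
qed

lemma nabla_mult_left: "nabla (\<lambda>y. a * f y) x = a * nabla f x"
  by (simp add: nabla_def algebra_simps)

lemma nabla_shift: "nabla (\<lambda>y. f (y - a)) x = nabla f (x - a)"
  by (simp add: nabla_def algebra_simps)

lemma nabla_funpow_meixner:
  fixes b :: "'a::field_char_0"
  assumes b: "\<And>j. b + of_nat j \<noteq> 0"
  shows "(nabla ^^ k) (\<lambda>y. meixner n y b c) =
    (\<lambda>x. pochhammer (- of_nat n) k * (- ((c - 1) / c)) ^ k / pochhammer b k
      * meixner (n - k) (x - of_nat k) (b + of_nat k) c)"
proof (induction k)
  case (Suc k)
  define z where "z = (c - 1) / c"
  have bk: "b + of_nat k + of_nat j \<noteq> 0" for j using b[of "k + j"] by (simp add: add.assoc)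
  (* for k > n both sides are 0, since the rising factorials contain the factor 0 *)
  have poch: "pochhammer (- of_nat n :: 'a) k * of_nat (n - k) = - pochhammer (- of_nat n) (Suc k)"
    by (cases "k \<le> n") (simp_all add: pochhammer_Suc of_nat_diff algebra_simps pochhammer_of_nat_eq_0_iff)
  show ?case
  proof
    fix x
    have "(nabla ^^ Suc k) (\<lambda>y. meixner n y b c) x =
      nabla (\<lambda>y. pochhammer (- of_nat n) k * (- z) ^ k / pochhammer b k
        * meixner (n - k) (y - of_nat k) (b + of_nat k) c) x"
      by (simp add: Suc.IH z_def)
    also have "\<dots> = pochhammer (- of_nat n) k * (- z) ^ k / pochhammer b k
       * (of_nat (n - k) * z / (b + of_nat k) * meixner (n - Suc k) (x - of_nat k - 1) (b + of_nat k + 1) c)"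
      unfolding nabla_mult_left nabla_shift[of "\<lambda>y. meixner (n - k) y (b + of_nat k) c"]
        nabla_meixner[OF bk] z_def by simp
    also have "\<dots> = (pochhammer (- of_nat n) k * of_nat (n - k)) * ((- z) ^ k * z)
        / (pochhammer b k * (b + of_nat k)) * meixner (n - Suc k) (x - of_nat k - 1) (b + of_nat k + 1) c"
      by simp
    also have "\<dots> = pochhammer (- of_nat n) (Suc k) * (- z) ^ Suc k / pochhammer b (Suc k)
      * meixner (n - Suc k) (x - of_nat (Suc k)) (b + of_nat (Suc k)) c"
      by (simp only: poch pochhammer_Suc[of b]) (simp add: algebra_simps)
    finally show "(nabla ^^ Suc k) (\<lambda>y. meixner n y b c) x =
      pochhammer (- of_nat n) (Suc k) * (- ((c - 1) / c)) ^ Suc k / pochhammer b (Suc k)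
      * meixner (n - Suc k) (x - of_nat (Suc k)) (b + of_nat (Suc k)) c" by (simp only: z_def)
  qed
qed simp

text \<open>
  This is \<open>f \<mapsto> \<nabla>(w\<^bsub>b+1\<^esub> f) / w\<^sub>b\<close>, computed from
  \<open>w\<^bsub>b+1\<^esub> x / w\<^sub>b x = (b + x) / b\<close> and \<open>w\<^bsub>b+1\<^esub> (x - 1) / w\<^sub>b x = x / (b c)\<close>.
\<close>
definition raise :: "'a \<Rightarrow> 'a \<Rightarrow> ('a \<Rightarrow> 'a) \<Rightarrow> 'a \<Rightarrow> 'a::field_char_0" where
  "raise c b f x = ((b + x) * f x - x / c * f (x - 1)) / b"

text \<open>
  Both sides are compared in the basis \<open>(-x)\<^sub>j z\<^sup>j\<close> with \<open>z = (c - 1) / c\<close>, for which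
  \<open>x (1 - x)\<^sub>j = - (-x)\<^bsub>j+1\<^esub>\<close>, \<open>(b + x) (-x)\<^sub>j = (b + j) (-x)\<^sub>j - (-x)\<^bsub>j+1\<^esub>\<close> and
  \<open>1 / c = 1 - z\<close>.
\<close>
lemma meixner_Suc_eq_raise:
  fixes b :: "'a::field_char_0"
  assumes b: "\<And>j. b + of_nat j \<noteq> 0" and c: "c \<noteq> 0"
  shows "meixner (Suc n) x b c = raise c b (\<lambda>y. meixner n y (b + 1) c) x"
proof -
  define z where "z = (c - 1) / c"
  have c': "1 / c = 1 - z" using c by (simp add: z_def field_simps)
  have b0: "b \<noteq> 0" using b[of 0] by simp
  have bp: "pochhammer b j \<noteq> 0" for j by (rule pochhammer_neq_0[OF b])
  have b1: "pochhammer (b + 1) j \<noteq> 0" for j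
    using bp[of "Suc j"] by (simp add: pochhammer_rec)
  define A where "A j = pochhammer (- of_nat n) j / (pochhammer (b + 1) j * fact j) * z ^ j" for j
  define P where "P j = pochhammer (- x) j" for j
  have P: "x * P j = of_nat j * P j - P (Suc j)" for j
    by (simp add: P_def pochhammer_Suc algebra_simps)
  have Q: "x * pochhammer (1 - x) j = - P (Suc j)" for j
    by (simp add: P_def pochhammer_rec)
  have M1: "meixner n x (b + 1) c = (\<Sum>j\<le>Suc n. A j * P j)"
    unfolding meixner_extend[of n "Suc n", OF le_SucI[OF order_refl]]
    by (simp only: A_def P_def z_def) (simp add: mult_ac)
  have M2: "meixner n (x - 1) (b + 1) c = (\<Sum>j\<le>Suc n. A j * pochhammer (1 - x) j)"
    unfolding meixner_extend[of n "Suc n", OF le_SucI[OF order_refl]]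
    by (simp only: A_def z_def) (simp add: mult_ac)
  have split: "(b + x) * (A j * P j) - (1 - z) * x * (A j * pochhammer (1 - x) j)
      = A j * (b + of_nat j) * P j - z * A j * P (Suc j)" for j
  proof -
    have "(b + x) * (A j * P j) - (1 - z) * x * (A j * pochhammer (1 - x) j)
      = A j * (b * P j + x * P j - (1 - z) * (x * pochhammer (1 - x) j))"
      by (simp add: algebra_simps)
    then show ?thesis unfolding P Q by (simp add: algebra_simps)
  qed
  have "(b + x) * meixner n x (b + 1) c - x / c * meixner n (x - 1) (b + 1) c
      = (b + x) * meixner n x (b + 1) c - (1 - z) * x * meixner n (x - 1) (b + 1) c"
    by (simp add: c'[symmetric])
  also have "\<dots> = (\<Sum>j\<le>Suc n. A j * (b + of_nat j) * P j - z * A j * P (Suc j))"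
    by (simp only: M1 M2 sum_distrib_left sum_subtractf[symmetric] split)
  also have "\<dots> = (\<Sum>j\<le>Suc n. A j * (b + of_nat j) * P j) - (\<Sum>j\<le>n. z * A j * P (Suc j))"
  proof -
    have "A (Suc n) = 0" by (simp add: A_def pochhammer_of_nat_eq_0_iff)
    then show ?thesis by (simp add: sum_subtractf)
  qed
  also have "\<dots> = A 0 * b * P 0
      + (\<Sum>j\<le>n. (A (Suc j) * (b + of_nat (Suc j)) - z * A j) * P (Suc j))"
    by (subst sum.atMost_Suc_shift)
      (simp only: sum_subtractf left_diff_distrib of_nat_0 add_0_right add_diff_eq)
  also have "\<dots> = b * (pochhammer (- of_nat (Suc n)) 0 * P 0 / (pochhammer b 0 * fact 0) * z ^ 0
      + (\<Sum>j\<le>n. pochhammer (- of_nat (Suc n)) (Suc j) * P (Suc j)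
          / (pochhammer b (Suc j) * fact (Suc j)) * z ^ Suc j))"
  proof -
    have "A (Suc j) * (b + of_nat (Suc j)) - z * A j
        = b * (pochhammer (- of_nat (Suc n)) (Suc j) / (pochhammer b (Suc j) * fact (Suc j)) * z ^ Suc j)" for j
    proof -
      have p1: "pochhammer (b + 1) (Suc j) = pochhammer (b + 1) j * (b + of_nat (Suc j))"
        by (simp add: pochhammer_Suc algebra_simps)
      have p2: "pochhammer b (Suc j) = b * pochhammer (b + 1) j"
        by (rule pochhammer_rec)
      have p3: "pochhammer (- of_nat (Suc n)) (Suc j) = - of_nat (Suc n) * pochhammer (- of_nat n :: 'a) j"
        by (simp add: pochhammer_rec)
      have p4: "pochhammer (- of_nat n :: 'a) (Suc j) = pochhammer (- of_nat n) j * (of_nat j - of_nat n)"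
        by (simp add: pochhammer_Suc algebra_simps)
      have f: "fact (Suc j) = (of_nat (Suc j) * fact j :: 'a)" by (rule fact_Suc)
      have nz: "(of_nat (Suc j) :: 'a) \<noteq> 0" "(fact j :: 'a) \<noteq> 0" "b + of_nat (Suc j) \<noteq> 0"
        by (simp_all only: of_nat_neq_0 fact_nonzero b not_False_eq_True)
      let ?K = "pochhammer (- of_nat n) j / (pochhammer (b + 1) j * fact j * of_nat (Suc j)) * z ^ Suc j"
      have "A (Suc j) * (b + of_nat (Suc j)) = ?K * (of_nat j - of_nat n)"
        unfolding A_def p1 p4 f using nz b1[of j] by (simp add: divide_simps del: of_nat_Suc)
      moreover have "z * A j = ?K * of_nat (Suc j)"
        unfolding A_def using nz b1[of j] by (simp add: divide_simps del: of_nat_Suc)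
      moreover have "b * (pochhammer (- of_nat (Suc n)) (Suc j) / (pochhammer b (Suc j) * fact (Suc j)) * z ^ Suc j)
          = ?K * (- of_nat (Suc n))"
        unfolding p2 p3 f using nz b1[of j] b0 by (simp add: divide_simps del: of_nat_Suc)
      ultimately show ?thesis by (simp only: right_diff_distrib[symmetric]) simp
    qed
    moreover have "A 0 = 1" by (simp add: A_def)
    ultimately show ?thesis
      by (simp add: distrib_left sum_distrib_left mult_ac)
  qed
  also have "\<dots> = b * meixner (Suc n) x b c"
    unfolding meixner_extend[OF order_refl] sum.atMost_Suc_shift P_def z_def by simp
  finally show ?thesis using b0 by (simp add: raise_def)
qed

section \<open>Iterating the raising operator\<close>

text \<open>
  The weight parameter goes up by one at each inner step, so that the iterate is
  \<open>f \<mapsto> \<nabla>\<^sup>n(w\<^bsub>b+n\<^esub> f) / w\<^sub>b\<close> rather than a power of one fixed operator.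
\<close>
primrec raise_iter :: "'a \<Rightarrow> nat \<Rightarrow> 'a \<Rightarrow> ('a \<Rightarrow> 'a) \<Rightarrow> 'a \<Rightarrow> 'a::field_char_0" where
  "raise_iter c 0 b f = f"
| "raise_iter c (Suc n) b f = raise c b (raise_iter c n (b + 1) f)"

lemma shifted_param_neq_0:
  fixes b :: "'a::field_char_0"
  assumes "\<And>j. b + of_nat j \<noteq> 0"
  shows "b + 1 + of_nat j \<noteq> 0"
  using assms[of "Suc j"] by (simp add: add.assoc)

lemma meixner_add_eq_raise_iter:
  fixes b :: "'a::field_char_0"
  assumes "\<And>j. b + of_nat j \<noteq> 0" and c: "c \<noteq> 0"
  shows "(\<lambda>x. meixner (m + n) x b c) = raise_iter c n b (\<lambda>y. meixner m y (b + of_nat n) c)"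
  using assms(1)
proof (induction n arbitrary: b)
  case (Suc n)
  have "(\<lambda>x. meixner (m + n) x (b + 1) c) =
      raise_iter c n (b + 1) (\<lambda>y. meixner m y (b + 1 + of_nat n) c)"
    by (rule Suc.IH) (rule shifted_param_neq_0[OF Suc.prems])
  then have "raise_iter c (Suc n) b (\<lambda>y. meixner m y (b + of_nat (Suc n)) c) =
      raise c b (\<lambda>x. meixner (m + n) x (b + 1) c)"
    by (simp add: add_ac)
  then show ?case
    using meixner_Suc_eq_raise[OF Suc.prems c, of "m + n"] by (simp add: fun_eq_iff)
qed simp

text \<open>The one-step Leibniz rule \<open>\<nabla>(G h) = (\<nabla> G) h(\<cdot> - 1) + G (\<nabla> h)\<close>, with the weight divided out.\<close>
lemma raise_mult:
  "raise c b (\<lambda>y. g y * h y) x = raise c b g x * h (x - 1) + (b + x) / b * g x * nabla h x"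
  by (cases "b = 0") (simp_all add: raise_def nabla_def field_simps)

lemma raise_sum:
  "raise c b (\<lambda>y. \<Sum>k\<in>K. a k * f k y) x = (\<Sum>k\<in>K. a k * raise c b (f k) x)"
  by (simp add: raise_def sum_distrib_left sum_divide_distrib sum_subtractf[symmetric]
      right_diff_distrib diff_divide_distrib mult_ac)

text \<open>The rising factorials form the quotient \<open>w\<^bsub>b+k+1\<^esub> / w\<^bsub>b+1\<^esub>\<close>, which changes the weight under \<open>\<nabla>\<close>.\<close>
lemma raise_weight_quotient:
  fixes b :: "'a::field_char_0"
  assumes b: "\<And>j. b + of_nat j \<noteq> 0"
  shows "raise c b (\<lambda>y. pochhammer (b + 1 + y) k / pochhammer (b + 1) k * g y) x =
    pochhammer (b + x) k / pochhammer b k * raise c (b + of_nat k) g x"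
proof -
  have nz: "b \<noteq> 0" "pochhammer b k \<noteq> 0" "b + of_nat k \<noteq> 0"
    using b[of 0] b[of k] pochhammer_neq_0[OF b] by auto
  have "b * pochhammer (b + 1) k = pochhammer b k * (b + of_nat k)"
    using pochhammer_rec[of b k] pochhammer_Suc[of b k] by simp
  then have w: "pochhammer (b + 1) k = pochhammer b k * (b + of_nat k) / b"
    using nz by (simp add: field_simps)
  have v: "(b + x) * pochhammer (b + 1 + x) k = pochhammer (b + x) k * (b + of_nat k + x)"
    using pochhammer_rec[of "b + x" k] pochhammer_Suc[of "b + x" k] by (simp add: add_ac)
  have "raise c b (\<lambda>y. pochhammer (b + 1 + y) k / pochhammer (b + 1) k * g y) x =
    (((b + x) * pochhammer (b + 1 + x) k) * g x - x / c * pochhammer (b + x) k * g (x - 1))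
      / (b * pochhammer (b + 1) k)"
    by (simp add: raise_def diff_divide_distrib mult_ac)
  also have "\<dots> = pochhammer (b + x) k / pochhammer b k * raise c (b + of_nat k) g x"
    unfolding v w using nz by (simp add: raise_def diff_divide_distrib right_diff_distrib mult_ac)
  finally show ?thesis .
qed

text \<open>
  This is \<open>\<nabla>\<^sup>n(w\<^bsub>b+n\<^esub> f) = (\<Sum>k\<le>n. (n choose k) \<nabla>\<^bsup>n-k\<^esup> w\<^bsub>b+n\<^esub> \<cdot> (\<nabla>\<^sup>k f)(\<cdot> - (n - k)))\<close>
  divided by \<open>w\<^sub>b\<close>. The induction is the usual one: the two terms of the product rule
  recombine by Pascal's rule.
\<close>
lemma raise_iter_leibniz:
  fixes b :: "'a::field_char_0"
  assumes "\<And>j. b + of_nat j \<noteq> 0" and c: "c \<noteq> 0"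
  shows "raise_iter c n b f x = (\<Sum>k\<le>n. of_nat (n choose k) *
    (pochhammer (b + x) k / pochhammer b k * meixner (n - k) x (b + of_nat k) c
      * (nabla ^^ k) f (x - of_nat (n - k))))"
  using assms(1)
proof (induction n arbitrary: b x)
  case 0
  then show ?case by simp
next
  case (Suc n)
  note b = Suc.prems
  define R where "R k = pochhammer (b + x) k / pochhammer b k * meixner (Suc n - k) x (b + of_nat k) c
      * (nabla ^^ k) f (x - of_nat (Suc n - k))" for k
  define G where "G k y = pochhammer (b + 1 + y) k / pochhammer (b + 1) k
      * meixner (n - k) y (b + 1 + of_nat k) c" for k y
  define h where "h k y = (nabla ^^ k) f (y - of_nat (n - k))" for k y
  have IH: "raise_iter c n (b + 1) f = (\<lambda>y. \<Sum>k\<le>n. of_nat (n choose k) * (G k y * h k y))"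
    using Suc.IH[OF shifted_param_neq_0[OF b]] by (simp add: fun_eq_iff G_def h_def)
  have step: "raise c b (\<lambda>y. G k y * h k y) x = R k + R (Suc k)" if "k \<le> n" for k
  proof -
    have bk: "b + of_nat k + of_nat j \<noteq> 0" for j
      using b[of "k + j"] by (simp add: add.assoc)
    have "raise c b (G k) x =
        pochhammer (b + x) k / pochhammer b k * meixner (Suc n - k) x (b + of_nat k) c"
      unfolding G_def raise_weight_quotient[OF b] Suc_diff_le[OF that] meixner_Suc_eq_raise[OF bk c]
      by (simp add: add_ac)
    moreover have "h k (x - 1) = (nabla ^^ k) f (x - of_nat (Suc n - k))"
      by (simp add: h_def Suc_diff_le[OF that] algebra_simps)
    moreover have "(b + x) / b * G k x =
        pochhammer (b + x) (Suc k) / pochhammer b (Suc k) * meixner (Suc n - Suc k) x (b + of_nat (Suc k)) c"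
      by (simp add: G_def pochhammer_rec add_ac)
    moreover have "nabla (h k) x = (nabla ^^ Suc k) f (x - of_nat (Suc n - Suc k))"
      unfolding h_def nabla_shift by simp
    ultimately show ?thesis by (simp only: raise_mult R_def)
  qed
  have "raise_iter c (Suc n) b f x = (\<Sum>k\<le>n. of_nat (n choose k) * (R k + R (Suc k)))"
    by (simp add: IH raise_sum step)
  also have "\<dots> = (\<Sum>k\<le>Suc n. of_nat (n choose k) * R k) + (\<Sum>k\<le>n. of_nat (n choose k) * R (Suc k))"
    by (simp add: distrib_left sum.distrib)
  also have "\<dots> = (\<Sum>k\<le>Suc n. of_nat (Suc n choose k) * R k)"
    by (simp add: sum.atMost_Suc_shift sum.distrib distrib_right del: sum.atMost_Suc)
  finally show ?case by (simp only: R_def)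
qed

section \<open>The addition formula for the degree\<close>

theorem mainTheorem7:
  fixes \<beta> c :: real and n m :: nat and x :: "'a::real_field"
  assumes "\<beta> > 0" and "0 < c" and "c < 1"
  shows "meixner (m + n) x (of_real \<beta>) (of_real c) =
    (\<Sum>k=0..min n m.
       pochhammer (- of_nat n) k * pochhammer (- of_nat m) k * pochhammer (of_real \<beta> + x) k
       / (fact k * pochhammer (of_real \<beta>) k * pochhammer (of_real \<beta> + of_nat n) k)
       * ((of_real c - 1) / of_real c) ^ k
       * meixner (n - k) x (of_real \<beta> + of_nat k) (of_real c)
       * meixner (m - k) (x - of_nat n) (of_real \<beta> + of_nat n + of_nat k) (of_real c))"
proof -
  define b where "b = (of_real \<beta> :: 'a)"
  define d where "d = (of_real c :: 'a)"
  have b: "b + of_nat j \<noteq> 0" for j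
  proof -
    have "b + of_nat j = of_real (\<beta> + real j)" by (simp add: b_def)
    also have "\<dots> \<noteq> 0" unfolding of_real_eq_0_iff using assms(1) by linarith
    finally show ?thesis .
  qed
  have bn: "b + of_nat n + of_nat j \<noteq> 0" for j
    using b[of "n + j"] by (simp add: add.assoc)
  have d: "d \<noteq> 0" using assms(2) by (simp add: d_def)
  let ?T = "\<lambda>k. pochhammer (- of_nat n) k * pochhammer (- of_nat m) k * pochhammer (b + x) k
       / (fact k * pochhammer b k * pochhammer (b + of_nat n) k)
       * ((d - 1) / d) ^ k
       * meixner (n - k) x (b + of_nat k) d
       * meixner (m - k) (x - of_nat n) (b + of_nat n + of_nat k) d"
  have "meixner (m + n) x b d = raise_iter d n b (\<lambda>y. meixner m y (b + of_nat n) d) x"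
    using meixner_add_eq_raise_iter[OF b d, of m n] by (simp add: fun_eq_iff)
  also have "\<dots> = (\<Sum>k\<le>n. ?T k)"
    unfolding raise_iter_leibniz[OF b d] nabla_funpow_meixner[OF bn]
  proof (rule sum.cong[OF refl])
    fix k assume "k \<in> {..n}"
    then have sh: "x - of_nat (n - k) - of_nat k = x - of_nat n" by (simp add: of_nat_diff)
    (* the signs of the binomial coefficient and of the k-th difference cancel *)
    have bin: "(of_nat (n choose k) :: 'a) = (- 1) ^ k * pochhammer (- of_nat n) k / fact k"
      by (simp add: binomial_gbinomial gbinomial_pochhammer)
    have sgn: "(- 1) ^ k * (- ((d - 1) / d)) ^ k = ((d - 1) / d) ^ k"
      by (simp only: power_mult_distrib[symmetric] mult_minus_left mult_minus_right minus_minus mult_1_left)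
    show "of_nat (n choose k) * (pochhammer (b + x) k / pochhammer b k * meixner (n - k) x (b + of_nat k) d *
          (pochhammer (- of_nat m) k * (- ((d - 1) / d)) ^ k / pochhammer (b + of_nat n) k *
           meixner (m - k) (x - of_nat (n - k) - of_nat k) (b + of_nat n + of_nat k) d)) = ?T k"
      unfolding sh bin sgn[symmetric] by (simp only: times_divide_eq_left times_divide_eq_right divide_divide_eq_left mult_ac)
  qed
  also have "\<dots> = (\<Sum>k=0..min n m. ?T k)"
    unfolding atMost_atLeast0
    by (rule sum.mono_neutral_right) (auto simp: pochhammer_of_nat_eq_0_iff)
  finally show ?thesis by (simp only: b_def d_def)
qed

end
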